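(* Let $(X,d)$ be a metric space and let $\Phi$ be a topological flow or semiflow (continuous-time or discrete-time) on $X$. Let $\mathscr{T}(\Phi)$ be the set of trapping regions for $\Phi$. Then $$X\setminus\mathrm{ChRec}(\Phi)=\bigcup_{\mathcal{T}\in\mathscr{T}(\Phi)}\bigl(\mathrm{Orb}^-(\mathcal{T})\setminus A_{\mathcal{T}}\bigr),$$ where $A_{\mathcal{T}}$ is the attracting set associated with the trapping region $\mathcal{T}$.
   Context: $\mathbb{T}$ denotes either $\mathbb{R}$ (continuous time) or $\mathbb{Z}$ (discrete time), and $\mathbb{T}_{\ge 0}$, $\mathbb{T}_{>0}$, $\mathbb{T}_{\ge T}$ denote the sets of $t\in\mathbb{T}$ with $t\ge 0$, $t>0$, $t\ge T$. A topological semiflow on a topological space $X$ is a continuous map $\Phi\colon\mathbb{T}_{\ge 0}\times X\to X$ with $\Phi(0,x)=x$ and $\Phi(t_1,\Phi(t_2,x))=\Phi(t_1+t_2,x)$ for all $t_1,t_2\in\mathbb{T}_{\ge0}$, $x\in X$. A topological flow is a continuous map $\Phi\colon\mathbb{T}\times X\to X$ with the same properties for all $t_1,t_2\in\mathbb{T}$. A trapping region for $\Phi$ is a nonempty subset $\mathcal{T}\subseteq X$ for which there exists $T\in\mathbb{T}_{>0}$ with $\mathrm{cl}(\Phi(\mathbb{T}_{\ge T}\times\mathcal{T}))\subseteq\mathrm{int}(\mathcal{T})$. Its attracting set is $A_{\mathcal{T}}=\bigcap_{t\in\mathbb{T}_{\ge0}}\mathrm{cl}(\Phi(\mathbb{T}_{\ge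 t}\times\mathcal{T}))$. For $S\subseteq X$, $\mathrm{Orb}^-(S)=\{x\in X : \Phi(t,x)\in S\text{ for some }t\in\mathbb{T}_{\ge0}\}$. Chains. An error function is a continuous function $\varepsilon\colon X\to\mathbb{R}_{>0}$. For $x,y\in X$, an error function $\varepsilon$, and $T\in\mathbb{T}_{>0}$, an $(\varepsilon,T)$-chain for $\Phi$ from $x$ to $y$ consists of an integer $k\ge1$, points $x_0,\dots,x_k\in X$ and times $t_0,\dots,t_{k-1}\in\mathbb{T}_{\ge T}$ with $x_0=x$, $x_k=y$ and $d(\Phi(t_j,x_j),x_{j+1})<\varepsilon(\Phi(t_j,x_j))$ for $j\in\{0,\dots,k-1\}$. A point $x$ is chain recurrent for $\Phi$ if, for each error function $\varepsilon$ and each $T\in\mathbb{T}_{>0}$, there is an $(\varepsilon,T)$-chain from $x$ to itself; $\mathrm{ChRec}(\Phi)$ is the set of chain recurrent points. *)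

theory Defs
  imports "HOL-Analysis.Analysis"
begin

text \<open>
  The time domain is a set \<open>TT\<close> of reals, equal to \<open>UNIV\<close> (continuous time) or to \<open>\<int>\<close>
  (discrete time). The subspace topology on \<open>\<int>\<close> is the discrete one, so \<open>continuous_on\<close>
  is the intended continuity in both cases. Values of \<open>\<Phi>\<close> at times outside its domain are
  unconstrained and are not used by any definition.
\<close>

definition time_domain :: "real set \<Rightarrow> bool" where
  "time_domain TT \<longleftrightarrow> TT = UNIV \<or> TT = \<int>"

definition time_ge :: "real set \<Rightarrow> real \<Rightarrow> real set" where
  "time_ge TT s = {t \<in> TT. s \<le> t}"

definition time_pos :: "real set \<Rightarrow> real set" where
  "time_pos TT = {t \<in> TT. 0 < t}"

definition topological_semiflow ::
    "real set \<Rightarrow> (real \<times> 'a::topological_space \<Rightarrow> 'a) \<Rightarrow> bool" where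
  "topological_semiflow TT \<Phi> \<longleftrightarrow>
     continuous_on (time_ge TT 0 \<times> UNIV) \<Phi> \<and>
     (\<forall>x. \<Phi> (0, x) = x) \<and>
     (\<forall>t1\<in>time_ge TT 0. \<forall>t2\<in>time_ge TT 0. \<forall>x. \<Phi> (t1, \<Phi> (t2, x)) = \<Phi> (t1 + t2, x))"

definition topological_flow ::
    "real set \<Rightarrow> (real \<times> 'a::topological_space \<Rightarrow> 'a) \<Rightarrow> bool" where
  "topological_flow TT \<Phi> \<longleftrightarrow>
     continuous_on (TT \<times> UNIV) \<Phi> \<and>
     (\<forall>x. \<Phi> (0, x) = x) \<and>
     (\<forall>t1\<in>TT. \<forall>t2\<in>TT. \<forall>x. \<Phi> (t1, \<Phi> (t2, x)) = \<Phi> (t1 + t2, x))"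

definition trapping_regions ::
    "real set \<Rightarrow> (real \<times> 'a::topological_space \<Rightarrow> 'a) \<Rightarrow> 'a set set" where
  "trapping_regions TT \<Phi> =
     {S. S \<noteq> {} \<and> (\<exists>T\<in>time_pos TT. closure (\<Phi> ` (time_ge TT T \<times> S)) \<subseteq> interior S)}"

definition attracting_set ::
    "real set \<Rightarrow> (real \<times> 'a::topological_space \<Rightarrow> 'a) \<Rightarrow> 'a set \<Rightarrow> 'a set" where
  "attracting_set TT \<Phi> S = (\<Inter>t\<in>time_ge TT 0. closure (\<Phi> ` (time_ge TT t \<times> S)))"

definition backward_orbit ::
    "real set \<Rightarrow> (real \<times> 'a \<Rightarrow> 'a) \<Rightarrow> 'a set \<Rightarrow> 'a set" where
  "backward_orbit TT \<Phi> S = {x. \<exists>t\<in>time_ge TT 0. \<Phi> (t, x) \<in> S}"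

definition error_function :: "('a::topological_space \<Rightarrow> real) \<Rightarrow> bool" where
  "error_function \<epsilon> \<longleftrightarrow> continuous_on UNIV \<epsilon> \<and> (\<forall>x. 0 < \<epsilon> x)"

text \<open>
  In a chain of length \<open>k\<close> only \<open>p 0, \<dots>, p k\<close> and \<open>\<tau> 0, \<dots>, \<tau> (k - 1)\<close> matter.
\<close>

definition chain_from_to ::
    "real set \<Rightarrow> (real \<times> 'a::metric_space \<Rightarrow> 'a) \<Rightarrow> ('a \<Rightarrow> real) \<Rightarrow> real \<Rightarrow>
     'a \<Rightarrow> 'a \<Rightarrow> nat \<Rightarrow> (nat \<Rightarrow> 'a) \<Rightarrow> (nat \<Rightarrow> real) \<Rightarrow> bool" where
  "chain_from_to TT \<Phi> \<epsilon> T x y k p \<tau> \<longleftrightarrow>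
     1 \<le> k \<and> p 0 = x \<and> p k = y \<and>
     (\<forall>j<k. \<tau> j \<in> time_ge TT T \<and>
            dist (\<Phi> (\<tau> j, p j)) (p (Suc j)) < \<epsilon> (\<Phi> (\<tau> j, p j)))"

definition ChRec :: "real set \<Rightarrow> (real \<times> 'a::metric_space \<Rightarrow> 'a) \<Rightarrow> 'a set" where
  "ChRec TT \<Phi> =
     {x. \<forall>\<epsilon>. error_function \<epsilon> \<longrightarrow>
          (\<forall>T\<in>time_pos TT. \<exists>k p \<tau>. chain_from_to TT \<Phi> \<epsilon> T x x k p \<tau>)}"

end

theory Submission
  imports Defs
begin

text \<open>
  If no \<open>(\<epsilon>, T)\<close>-chain returns to \<open>x\<close>, then the set of endpoints of \<open>(\<epsilon>, T)\<close>-chains from \<open>x\<close> is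
  an open trapping region that contains \<open>\<Phi> (T, x)\<close> but not \<open>x\<close>. Conversely, let \<open>S\<close> be a trapping
  region with \<open>x \<in> Orb\<^sup>-(S) - A\<^sub>S\<close>. For large \<open>T\<close> the closed set
  \<open>C = cl \<Phi>(TT\<^bsub>\<ge>T\<^esub> \<times> S)\<close> lies in the open set \<open>U = int S - {x}\<close>. An error function
  that on \<open>C\<close> is the distance to the complement of \<open>U\<close> keeps every chain from \<open>x\<close> inside
  \<open>U\<close>, so no chain returns to \<open>x\<close>.
\<close>

text \<open>Chains make at least one jump, so \<open>x\<close> is not automatically a member; its
  membership means exactly that some chain returns to \<open>x\<close>.\<close>

definition chain_reachable ::
    "real set \<Rightarrow> (real \<times> 'a::metric_space \<Rightarrow> 'a) \<Rightarrow> ('a \<Rightarrow> real) \<Rightarrow> real \<Rightarrow> 'a \<Rightarrow> 'a set" where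
  "chain_reachable TT \<Phi> \<epsilon> T x = {y. \<exists>k p \<tau>. chain_from_to TT \<Phi> \<epsilon> T x y k p \<tau>}"

lemma chain_reachable_step:
  assumes "t \<in> time_ge TT T" and "dist (\<Phi> (t, x)) y < \<epsilon> (\<Phi> (t, x))"
  shows "y \<in> chain_reachable TT \<Phi> \<epsilon> T x"
proof -
  have "chain_from_to TT \<Phi> \<epsilon> T x y 1 (\<lambda>j. if j = 0 then x else y) (\<lambda>_. t)"
    using assms by (simp add: chain_from_to_def)
  then show ?thesis
    unfolding chain_reachable_def by blast
qed

lemma chain_reachable_extend:
  assumes "y \<in> chain_reachable TT \<Phi> \<epsilon> T x"
    and "t \<in> time_ge TT T" and "dist (\<Phi> (t, y)) z < \<epsilon> (\<Phi> (t, y))"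
  shows "z \<in> chain_reachable TT \<Phi> \<epsilon> T x"
proof -
  obtain k p \<tau> where "chain_from_to TT \<Phi> \<epsilon> T x y k p \<tau>"
    using assms(1) unfolding chain_reachable_def by blast
  then have "chain_from_to TT \<Phi> \<epsilon> T x z (Suc k) (p(Suc k := z)) (\<tau>(k := t))"
    using assms(2,3) by (auto simp: chain_from_to_def less_Suc_eq)
  then show ?thesis
    unfolding chain_reachable_def by blast
qed

text \<open>Induction along the points of a chain after its start. The first jump is a case of its
  own, so that \<open>P\<close> may fail at \<open>x\<close> itself.\<close>

lemma chain_reachable_induct [consumes 1, case_names step extend]:
  assumes "y \<in> chain_reachable TT \<Phi> \<epsilon> T x"
    and step: "\<And>t z. t \<in> time_ge TT T \<Longrightarrow> dist (\<Phi> (t, x)) z < \<epsilon> (\<Phi> (t, x)) \<Longrightarrow> P z"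
    and extend: "\<And>w t z. P w \<Longrightarrow> t \<in> time_ge TT T \<Longrightarrow> dist (\<Phi> (t, w)) z < \<epsilon> (\<Phi> (t, w)) \<Longrightarrow> P z"
  shows "P y"
proof -
  obtain k p \<tau> where k: "1 \<le> k" "p 0 = x" "p k = y"
    and c: "\<And>j. j < k \<Longrightarrow> \<tau> j \<in> time_ge TT T \<and>
      dist (\<Phi> (\<tau> j, p j)) (p (Suc j)) < \<epsilon> (\<Phi> (\<tau> j, p j))"
    using assms(1) unfolding chain_reachable_def chain_from_to_def by blast
  have "P (p (Suc j))" if "j < k" for j
    using that
  proof (induction j)
    case 0
    then show ?case using c[of 0] k(2) by (auto intro: step)
  next
    case (Suc j)
    then show ?case using c[of "Suc j"] by (auto intro: extend)
  qed
  from this[of "k - 1"] show ?thesis using k by simp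
qed

lemma not_ChRec_iff:
  "x \<notin> ChRec TT \<Phi> \<longleftrightarrow>
    (\<exists>\<epsilon> T. error_function \<epsilon> \<and> T \<in> time_pos TT \<and> x \<notin> chain_reachable TT \<Phi> \<epsilon> T x)"
  by (auto simp: ChRec_def chain_reachable_def)

text \<open>The last jump of a chain satisfies a strict inequality, and its slack is a radius within
  which the endpoint can be moved.\<close>

lemma open_chain_reachable: "open (chain_reachable TT \<Phi> \<epsilon> T x)"
  unfolding open_dist
proof
  fix y assume "y \<in> chain_reachable TT \<Phi> \<epsilon> T x"
  then have "\<exists>w t. (w = x \<or> w \<in> chain_reachable TT \<Phi> \<epsilon> T x) \<and>
      t \<in> time_ge TT T \<and> dist (\<Phi> (t, w)) y < \<epsilon> (\<Phi> (t, w))"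
  proof -
    \<comment> \<open>The induction rule passes on only \<open>P w\<close>, so reachability of
      \<open>w\<close> has to be carried along in the induction predicate.\<close>
    have "y \<in> chain_reachable TT \<Phi> \<epsilon> T x \<and> ?thesis"
      using \<open>y \<in> chain_reachable TT \<Phi> \<epsilon> T x\<close>
      by (induction rule: chain_reachable_induct)
        (metis chain_reachable_step chain_reachable_extend)+
    then show ?thesis by blast
  qed
  then obtain w t where w: "w = x \<or> w \<in> chain_reachable TT \<Phi> \<epsilon> T x" and t: "t \<in> time_ge TT T"
    and d: "dist (\<Phi> (t, w)) y < \<epsilon> (\<Phi> (t, w))"
    by blast
  have "z \<in> chain_reachable TT \<Phi> \<epsilon> T x" if "dist z y < \<epsilon> (\<Phi> (t, w)) - dist (\<Phi> (t, w)) y" for z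
  proof -
    have "dist (\<Phi> (t, w)) z < \<epsilon> (\<Phi> (t, w))"
      using that dist_triangle[of "\<Phi> (t, w)" z y] by (simp add: dist_commute)
    with w t show ?thesis
      by (auto intro: chain_reachable_step chain_reachable_extend)
  qed
  moreover have "0 < \<epsilon> (\<Phi> (t, w)) - dist (\<Phi> (t, w)) y"
    using d by simp
  ultimately show "\<exists>e>0. \<forall>z. dist z y < e \<longrightarrow> z \<in> chain_reachable TT \<Phi> \<epsilon> T x"
    by blast
qed

text \<open>By continuity \<open>\<epsilon>\<close> exceeds \<open>\<epsilon> z / 2\<close> near
  \<open>z\<close>. An image point close enough to \<open>z\<close> can therefore jump to
  \<open>z\<close> itself, which prolongs the chain.\<close>

lemma closure_image_chain_reachable_subset:
  assumes "error_function \<epsilon>"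
  shows "closure (\<Phi> ` (time_ge TT T \<times> chain_reachable TT \<Phi> \<epsilon> T x)) \<subseteq> chain_reachable TT \<Phi> \<epsilon> T x"
proof
  fix z assume z: "z \<in> closure (\<Phi> ` (time_ge TT T \<times> chain_reachable TT \<Phi> \<epsilon> T x))"
  have pos: "0 < \<epsilon> z / 2" and cont: "isCont \<epsilon> z"
    using assms by (auto simp: error_function_def continuous_on_eq_continuous_at)
  then obtain \<delta> where \<delta>: "0 < \<delta>" "\<And>w. dist w z < \<delta> \<Longrightarrow> dist (\<epsilon> w) (\<epsilon> z) < \<epsilon> z / 2"
    unfolding continuous_at_eps_delta by blast
  obtain t y where t: "t \<in> time_ge TT T" and y: "y \<in> chain_reachable TT \<Phi> \<epsilon> T x"
    and d: "dist (\<Phi> (t, y)) z < min \<delta> (\<epsilon> z / 2)"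
  proof -
    have "0 < min \<delta> (\<epsilon> z / 2)"
      using pos \<delta>(1) by simp
    with z show ?thesis
      using that unfolding closure_approachable by blast
  qed
  from \<delta>(2)[of "\<Phi> (t, y)"] d have "\<epsilon> z / 2 < \<epsilon> (\<Phi> (t, y))"
    by (auto simp: dist_real_def abs_if field_simps split: if_splits)
  then show "z \<in> chain_reachable TT \<Phi> \<epsilon> T x"
    using chain_reachable_extend[OF y t, of z] d by simp
qed

lemma chain_reachable_trapping_region:
  assumes "error_function \<epsilon>" and "T \<in> time_pos TT"
  shows "chain_reachable TT \<Phi> \<epsilon> T x \<in> trapping_regions TT \<Phi>"
    and "x \<in> backward_orbit TT \<Phi> (chain_reachable TT \<Phi> \<epsilon> T x)"
    and "attracting_set TT \<Phi> (chain_reachable TT \<Phi> \<epsilon> T x) \<subseteq> chain_reachable TT \<Phi> \<epsilon> T x"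
proof -
  let ?S = "chain_reachable TT \<Phi> \<epsilon> T x"
  have T: "T \<in> time_ge TT T" "T \<in> time_ge TT 0"
    using assms(2) by (auto simp: time_pos_def time_ge_def)
  have S: "\<Phi> (T, x) \<in> ?S"
    using assms(1) T by (intro chain_reachable_step[of T]) (auto simp: error_function_def)
  show "?S \<in> trapping_regions TT \<Phi>"
    using S assms(2) closure_image_chain_reachable_subset[OF assms(1), of \<Phi> TT T x]
    by (auto simp: trapping_regions_def interior_open[OF open_chain_reachable])
  show "x \<in> backward_orbit TT \<Phi> ?S"
    using S T by (auto simp: backward_orbit_def)
  \<comment> \<open>The set at time \<open>T\<close> in the intersection already lies in
    \<open>?S\<close>.\<close>
  show "attracting_set TT \<Phi> ?S \<subseteq> ?S"
    using T closure_image_chain_reachable_subset[OF assms(1)]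
    unfolding attracting_set_def by blast
qed

lemma error_function_trapping:
  fixes C U :: "'a::metric_space set"
  assumes "closed C" "C \<noteq> {}" "open U" "U \<noteq> UNIV" "C \<subseteq> U"
  obtains \<epsilon> where "error_function \<epsilon>" "\<And>y z. y \<in> C \<Longrightarrow> dist y z < \<epsilon> y \<Longrightarrow> z \<in> U"
proof
  \<comment> \<open>The closed sets \<open>C\<close> and \<open>- U\<close> are disjoint, so the two
    distances never vanish together; on \<open>C\<close> only the first remains. Since
    \<open>infdist\<close> to the empty set is 0, positivity relies on both sets being
    nonempty.\<close>
  let ?\<epsilon> = "\<lambda>y. infdist y (- U) + infdist y C"
  have "0 < ?\<epsilon> y" for y
  proof (cases "y \<in> C")
    case True
    then have "0 < infdist y (- U)"
      using assms by (intro infdist_pos_not_in_closed) auto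
    then show ?thesis by (simp add: add_pos_nonneg infdist_nonneg)
  next
    case False
    then have "0 < infdist y C"
      using assms by (intro infdist_pos_not_in_closed) auto
    then show ?thesis by (simp add: add_nonneg_pos infdist_nonneg)
  qed
  then show "error_function ?\<epsilon>"
    by (auto simp: error_function_def intro!: continuous_intros)
  show "z \<in> U" if "y \<in> C" "dist y z < ?\<epsilon> y" for y z
    using that infdist_le[of z "- U" y] by force
qed

lemma time_domain_closed:
  assumes "time_domain TT" "s \<in> TT" "t \<in> TT"
  shows "s + t \<in> TT" "s - t \<in> TT"
  using assms by (auto simp: time_domain_def)

lemma topological_flow_imp_semiflow:
  assumes "topological_flow TT \<Phi>"
  shows "topological_semiflow TT \<Phi>"
  using assms unfolding topological_flow_def topological_semiflow_def time_ge_def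
  by (auto elim: continuous_on_subset)

lemma not_ChRec_if_trapping_region:
  assumes TT: "time_domain TT" and \<Phi>: "topological_semiflow TT \<Phi>"
    and S: "S \<in> trapping_regions TT \<Phi>"
    and orb: "x \<in> backward_orbit TT \<Phi> S" and att: "x \<notin> attracting_set TT \<Phi> S"
  shows "x \<notin> ChRec TT \<Phi>"
proof -
  obtain T where T: "T \<in> TT" "0 < T" and trap: "closure (\<Phi> ` (time_ge TT T \<times> S)) \<subseteq> interior S"
    using S by (auto simp: trapping_regions_def time_pos_def)
  obtain s where s: "s \<in> TT" "0 \<le> s" "\<Phi> (s, x) \<in> S"
    using orb by (auto simp: backward_orbit_def time_ge_def)
  obtain r where r: "r \<in> TT" "0 \<le> r" "x \<notin> closure (\<Phi> ` (time_ge TT r \<times> S))"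
    using att by (auto simp: attracting_set_def time_ge_def)
  \<comment> \<open>Waiting for \<open>T + r\<close> puts \<open>C\<close> inside
    \<open>interior S\<close> and away from \<open>x\<close> at once.\<close>
  define C where "C = closure (\<Phi> ` (time_ge TT (T + r) \<times> S))"
  \<comment> \<open>Removing a point keeps the set open, and it makes confinement to
    \<open>U\<close> rule out a return to \<open>x\<close>.\<close>
  define U where "U = interior S - {x}"
  have "C \<subseteq> closure (\<Phi> ` (time_ge TT T \<times> S))" "C \<subseteq> closure (\<Phi> ` (time_ge TT r \<times> S))"
    unfolding C_def using T r by (auto intro!: closure_mono image_mono simp: time_ge_def)
  then have CU: "C \<subseteq> U"
    using trap r(3) unfolding U_def by blast
  have into_C: "\<Phi> (t, y) \<in> C" if "t \<in> time_ge TT (T + r)" "y \<in> S" for t y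
    unfolding C_def using that by (intro subsetD[OF closure_subset] imageI) simp
  have "T + r \<in> time_ge TT (T + r)"
    using TT T r by (simp add: time_ge_def time_domain_closed)
  then have "C \<noteq> {}"
    using into_C s(3) by blast
  obtain \<epsilon> where \<epsilon>: "error_function \<epsilon>" "\<And>y z. y \<in> C \<Longrightarrow> dist y z < \<epsilon> y \<Longrightarrow> z \<in> U"
    using error_function_trapping[of C U] CU \<open>C \<noteq> {}\<close> by (auto simp: C_def U_def open_delete)
  \<comment> \<open>The extra time \<open>s\<close> serves the first jump: \<open>x\<close> need not
    lie in \<open>S\<close>, but \<open>\<Phi> (s, x)\<close> does, and at least
    \<open>T + r\<close> is left to flow from there into \<open>C\<close>.\<close>
  have "y \<in> U" if "y \<in> chain_reachable TT \<Phi> \<epsilon> (T + r + s) x" for y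
    using that
  proof (induction rule: chain_reachable_induct)
    case (step t z)
    have t: "t - s \<in> time_ge TT (T + r)" "t - s \<in> time_ge TT 0" "s \<in> time_ge TT 0"
      using step(1) TT T r s by (auto simp: time_ge_def time_domain_closed)
    then have "\<Phi> (t - s, \<Phi> (s, x)) = \<Phi> (t - s + s, x)"
      using \<Phi> unfolding topological_semiflow_def by blast
    then have "\<Phi> (t, x) \<in> C"
      using into_C[OF t(1) s(3)] by simp
    then show ?case using \<epsilon>(2) step(2) by blast
  next
    case (extend w t z)
    have "w \<in> S"
      using extend(1) interior_subset unfolding U_def by blast
    moreover have "t \<in> time_ge TT (T + r)"
      using extend(2) s by (auto simp: time_ge_def)
    ultimately show ?case
      using \<epsilon>(2) extend(3) into_C by blast
  qed
  then have "x \<notin> chain_reachable TT \<Phi> \<epsilon> (T + r + s) x"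
    unfolding U_def by blast
  moreover have "T + r + s \<in> time_pos TT"
    using TT T r s by (simp add: time_pos_def time_domain_closed)
  ultimately show ?thesis
    using \<epsilon>(1) not_ChRec_iff by blast
qed

theorem theorem4p4:
  fixes TT :: "real set" and \<Phi> :: "real \<times> 'a::metric_space \<Rightarrow> 'a"
  assumes "time_domain TT"
    and "topological_flow TT \<Phi> \<or> topological_semiflow TT \<Phi>"
  shows "UNIV - ChRec TT \<Phi> =
    (\<Union>S\<in>trapping_regions TT \<Phi>. backward_orbit TT \<Phi> S - attracting_set TT \<Phi> S)"
proof (intro equalityI subsetI)
  fix x assume "x \<in> UNIV - ChRec TT \<Phi>"
  then obtain \<epsilon> T where \<epsilon>T: "error_function \<epsilon>" "T \<in> time_pos TT"
    and "x \<notin> chain_reachable TT \<Phi> \<epsilon> T x"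
    using not_ChRec_iff by blast
  then show "x \<in> (\<Union>S\<in>trapping_regions TT \<Phi>. backward_orbit TT \<Phi> S - attracting_set TT \<Phi> S)"
    using chain_reachable_trapping_region[OF \<epsilon>T, where \<Phi> = \<Phi> and x = x] by blast
next
  fix x assume "x \<in> (\<Union>S\<in>trapping_regions TT \<Phi>. backward_orbit TT \<Phi> S - attracting_set TT \<Phi> S)"
  moreover have "topological_semiflow TT \<Phi>"
    using assms(2) topological_flow_imp_semiflow by blast
  ultimately show "x \<in> UNIV - ChRec TT \<Phi>"
    using not_ChRec_if_trapping_region[OF assms(1)] by blast
qed

end
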